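(* For any $n\ge1$ and any pattern pair $p\in\{(021,210),(021,201)\}$, we have $|\mathbf{I}_n(p)|=S_n$, where $S_n$ is the $n$-th large Schröder number, indexed so that $(S_n)_{n\ge1}=1,2,6,22,90,394,\dots$.
   Context: An inversion sequence of length $n$ is an integer sequence $e=(e_1,\dots,e_n)$ with $0\le e_i\le i-1$ for all $1\le i\le n$. A word $w_1\cdots w_n$ avoids a pattern $P=p_1\cdots p_k$ if there are no $i_1<\cdots<i_k$ such that $w_{i_1}\cdots w_{i_k}$ is order isomorphic to $P$ (equal letters of $P$ corresponding to equal entries). For a pair $p=(P_1,P_2)$ of patterns, $\mathbf{I}_n(p)$ denotes the set of inversion sequences of length $n$ avoiding both $P_1$ and $P_2$. A Schröder $m$-path is a lattice path in $\mathbb{N}^2$ (so never going below the $x$-axis) from $(0,0)$ to $(2m,0)$ using only the steps $(1,1)$, $(1,-1)$ and $(2,0)$. For $n\ge1$, $S_n$ is the number of Schröder $(n-1)$-paths. *)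

theory Defs
  imports Main "HOL-Library.Sublist" "HOL-Library.Product_Plus"
begin

(* Lists are indexed from 0, so the bound e_i <= i - 1 for 1 <= i <= n reads e ! i <= i for i < n. *)
definition inversion_sequences :: "nat \<Rightarrow> nat list set" where
  "inversion_sequences n = {e. length e = n \<and> (\<forall>i<n. e ! i \<le> i)}"

definition order_isomorphic :: "nat list \<Rightarrow> nat list \<Rightarrow> bool" where
  "order_isomorphic u v \<longleftrightarrow> length u = length v \<and>
     (\<forall>i<length v. \<forall>j<length v. (u ! i < u ! j \<longleftrightarrow> v ! i < v ! j) \<and> (u ! i = u ! j \<longleftrightarrow> v ! i = v ! j))"

(* subseq is the library's relation of being a not necessarily contiguous subsequence. *)
definition avoids :: "nat list \<Rightarrow> nat list \<Rightarrow> bool" where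
  "avoids w P \<longleftrightarrow> \<not> (\<exists>u. subseq u w \<and> order_isomorphic u P)"

definition inversion_sequences_avoiding :: "nat \<Rightarrow> nat list \<times> nat list \<Rightarrow> nat list set" where
  "inversion_sequences_avoiding n p =
     {e \<in> inversion_sequences n. avoids e (fst p) \<and> avoids e (snd p)}"

(* A path from (0,0) is given by its list of steps; its points are the sums of the prefixes
   of that list, and these must lie in the quadrant of nonnegative coordinates. *)
definition schroeder_paths :: "nat \<Rightarrow> (int \<times> int) list set" where
  "schroeder_paths m = {s. set s \<subseteq> {(1, 1), (1, -1), (2, 0)} \<and>
     (\<forall>k\<le>length s. 0 \<le> fst (sum_list (take k s)) \<and> 0 \<le> snd (sum_list (take k s))) \<and>
     sum_list s = (2 * int m, 0)}"

(* Only meant for n >= 1; the values for n = 1, 2, 3, ... are 1, 2, 6, 22, 90, 394, ... *)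
definition large_schroeder :: "nat \<Rightarrow> nat" where
  "large_schroeder n = card (schroeder_paths (n - 1))"

end

theory Submission
  imports Defs
begin

text \<open>
  An inversion sequence starts with \<open>0\<close>, so it contains \<open>021\<close> as soon as a larger entry precedes a
  smaller positive one, and \<open>210\<close> and \<open>201\<close> also contain such a descent between positive entries.
  Hence either pair of patterns is avoided exactly when the positive entries increase weakly
  (\<open>inversion_sequences_avoiding_eq\<close>), and it remains to count these sequences.

  If such a sequence is written from left to right, all that matters at any moment is the number
  \<open>k\<close> of positive values that may come next. Writing \<open>0\<close> turns \<open>k\<close> into \<open>k + 1\<close>, and the \<open>k\<close>
  positive values turn it into \<open>2, \<dots>, k + 1\<close>; this gives the numbers \<open>extension_count j k\<close> of
  extensions by \<open>j\<close> more entries. A path, in turn, is counted by removing its first step, which gives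
  the numbers \<open>descent_count j h\<close> of paths from height \<open>h\<close> down to \<open>0\<close> with \<open>j\<close> steps that are not
  down steps.

  The two recurrences are matched through their generating functions. Let \<open>S = 1 + x S + x S\<^sup>2\<close> be
  the generating function of the large Schroeder numbers. Paths from height \<open>h\<close> are enumerated by
  \<open>S ^ (h + 1)\<close>, and extensions in state \<open>k + 1\<close> by \<open>S s ^ k\<close>, where \<open>s = (1 + S) / 2\<close> enumerates the
  little Schroeder numbers. Expanding \<open>s ^ k\<close> by the binomial theorem and comparing coefficients,
  one obtains
  \<open>2 ^ k * extension_count j (k + 1) = (\<Sum>i\<le>k. (k choose i) * descent_count j i)\<close>.
  In this form the relation follows from the recurrences by induction
  (\<open>extension_count_binomial\<close>); for \<open>k = 0\<close> it is the theorem.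
\<close>

section \<open>Avoidance as monotonicity of the positive entries\<close>

abbreviation positive_part :: "nat list \<Rightarrow> nat list" where
  "positive_part w \<equiv> filter (\<lambda>x. 0 < x) w"

text \<open>A pattern in which a descent lies above a third letter can only occur at a descent between
  positive entries, since the value at the third letter is at least \<open>0\<close>.\<close>

lemma avoids_if_sorted_positive_part:
  assumes sorted: "sorted (positive_part w)"
    and pattern: "i < j" "j < length P" "k < length P" "P ! k < P ! j" "P ! j < P ! i"
  shows "avoids w P"
  unfolding avoids_def
proof
  assume "\<exists>u. subseq u w \<and> order_isomorphic u P"
  then obtain u where u: "subseq u w" "order_isomorphic u P" by blast
  have len: "length u = length P" and desc: "u ! k < u ! j" "u ! j < u ! i"
    using u(2) pattern by (auto simp: order_isomorphic_def)
  have "u = take j u @ u ! j # drop (Suc j) u"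
    using pattern(2) len by (simp add: id_take_nth_drop)
  moreover have "u ! i \<in> set (positive_part (take j u))"
    using pattern(1,2) len desc by (auto simp: in_set_conv_nth)
  moreover have "sorted (positive_part u)"
    using sorted subseq_filter[OF u(1), of "\<lambda>x. 0 < x"]
    by (auto simp: subseq_conv_nths sorted_nths)
  ultimately have "u ! i \<le> u ! j"
    using desc sorted_append[of "positive_part (take j u)" "u ! j # positive_part (drop (Suc j) u)"]
    by (metis filter.simps(2) filter_append gr_implies_not0 gr_zeroI list.set_intros(1))
  with desc show False by simp
qed

lemma sorted_positive_part_if_avoids_021:
  assumes "avoids (0 # w) [0, 2, 1]"
  shows "sorted (positive_part w)"
proof (rule ccontr)
  assume "\<not> sorted (positive_part w)"
  then obtain i j where ij: "i < j" "j < length (positive_part w)"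
      "positive_part w ! j < positive_part w ! i"
    by (auto simp: sorted_iff_nth_mono_less not_le)
  define v where "v = positive_part w"
  have v: "v = take j v @ v ! j # drop (Suc j) v"
    using ij(2) by (simp add: v_def id_take_nth_drop)
  have "v ! i \<in> set (take j v)"
    using ij by (auto simp: v_def in_set_conv_nth)
  then have "subseq ([v ! i] @ [v ! j]) (take j v @ v ! j # drop (Suc j) v)"
    by (intro list_emb_append_mono) (auto simp: subseq_singleton_left)
  then have "subseq [v ! i, v ! j] v" using v by simp
  then have "subseq [0, v ! i, v ! j] (0 # w)"
    by (simp add: v_def) (meson subseq_filter_left subseq_order.trans)
  moreover have "0 < v ! j"
    using ij(2) nth_mem[of j v] by (auto simp: v_def)
  then have "order_isomorphic [0, v ! i, v ! j] [0, 2, 1]"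
    using ij(3) by (auto simp: order_isomorphic_def v_def less_Suc_eq numeral_3_eq_3)
  ultimately show False using assms by (auto simp: avoids_def)
qed

lemma inversion_sequences_avoiding_eq:
  assumes "p \<in> {([0, 2, 1], [2, 1, 0]), ([0, 2, 1], [2, 0, 1])}"
  shows "inversion_sequences_avoiding n p = {e \<in> inversion_sequences n. sorted (positive_part e)}"
proof -
  have "sorted (positive_part e)" if "e \<in> inversion_sequences n" "avoids e [0, 2, 1]" for e
  proof (cases e)
    case (Cons x w)
    then have "x = 0" using that(1) by (auto simp: inversion_sequences_def)
    then show ?thesis using that(2) Cons sorted_positive_part_if_avoids_021 by simp
  qed simp
  moreover have "avoids e [0, 2, 1]" "avoids e [2, 1, 0]" "avoids e [2, 0, 1]"
    if "sorted (positive_part e)" for e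
    using avoids_if_sorted_positive_part[OF that, of 1 2 "[0, 2, 1]" 0]
      avoids_if_sorted_positive_part[OF that, of 0 1 "[2, 1, 0]" 2]
      avoids_if_sorted_positive_part[OF that, of 0 2 "[2, 0, 1]" 1]
    by simp_all
  ultimately show ?thesis
    using assms unfolding inversion_sequences_avoiding_def
    by (elim insertE emptyE; simp only: fst_conv snd_conv) blast+
qed

section \<open>Counting inversion sequences entry by entry\<close>

text \<open>The possible extensions by \<open>j\<close> entries of a sequence that has \<open>i\<close> entries and greatest
  entry \<open>m\<close>. The bound \<open>m\<close> is put in front of the positive part as if it were its first entry; as
  long as there is no positive entry, \<open>m = 1\<close> is the bound that says nothing.\<close>

definition extensions :: "nat \<Rightarrow> nat \<Rightarrow> nat \<Rightarrow> nat list set" where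
  "extensions i m j = {w. length w = j \<and> (\<forall>t<j. w ! t \<le> i + t) \<and> sorted (m # positive_part w)}"

fun extension_count :: "nat \<Rightarrow> nat \<Rightarrow> nat" where
  "extension_count 0 k = 1"
| "extension_count (Suc j) k = extension_count j (Suc k) + (\<Sum>t<k. extension_count j (t + 2))"

lemma extensions_0: "extensions i m 0 = {[]}"
  by (auto simp: extensions_def)

lemma extensions_Suc:
  assumes "0 < m"
  shows "extensions i m (Suc j) =
    Cons 0 ` extensions (Suc i) m j \<union> (\<Union>v\<in>{m..i}. Cons v ` extensions (Suc i) v j)"
    (is "?L = ?R")
proof -
  have bound: "(\<forall>t<Suc j. (v # w) ! t \<le> i + t) \<longleftrightarrow> v \<le> i \<and> (\<forall>t<j. w ! t \<le> Suc i + t)" for v w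
    by (simp add: All_less_Suc2)
  show ?thesis
  proof (intro set_eqI)
    fix w show "w \<in> ?L \<longleftrightarrow> w \<in> ?R"
    proof (cases w)
      case Nil
      then show ?thesis by (auto simp: extensions_def)
    next
      case (Cons v w')
      have "v # w' \<in> ?R \<longleftrightarrow> v = 0 \<and> w' \<in> extensions (Suc i) m j \<or>
          m \<le> v \<and> v \<le> i \<and> w' \<in> extensions (Suc i) v j"
        by auto
      then show ?thesis
        using assms bound[of v w'] Cons by (cases "v = 0") (auto simp: extensions_def)
    qed
  qed
qed

text \<open>The number of extensions depends on \<open>i\<close> and \<open>m\<close> only through the number \<open>i + 1 - m\<close> of
  positive values that are allowed next. In the empty sequence this number is \<open>0\<close>.\<close>

lemma card_extensions:
  assumes "0 < m" "m \<le> Suc i"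
  shows "finite (extensions i m j) \<and> card (extensions i m j) = extension_count j (Suc i - m)"
  using assms
proof (induction j arbitrary: i m)
  case 0
  then show ?case by (simp add: extensions_0)
next
  case (Suc j)
  let ?zero = "Cons 0 ` extensions (Suc i) m j"
  let ?pos = "\<lambda>v. Cons v ` extensions (Suc i) v j"
  have IH0: "finite (extensions (Suc i) m j)"
      "card (extensions (Suc i) m j) = extension_count j (Suc (Suc i - m))"
    using Suc.IH[of m "Suc i"] Suc.prems by (simp_all add: Suc_diff_le)
  have IH: "finite (extensions (Suc i) v j)"
      "card (extensions (Suc i) v j) = extension_count j (Suc (Suc i) - v)" if "v \<in> {m..i}" for v
    using Suc.IH[of v "Suc i"] Suc.prems that by auto
  have fin: "finite ?zero" "finite (\<Union>v\<in>{m..i}. ?pos v)"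
    using IH0 IH by auto
  have "card (\<Union>v\<in>{m..i}. ?pos v) = (\<Sum>v\<in>{m..i}. card (?pos v))"
    using IH by (intro card_UN_disjoint) auto
  also have "\<dots> = (\<Sum>v\<in>{m..i}. extension_count j (Suc (Suc i) - v))"
    using IH by (intro sum.cong) (auto simp: card_image)
  also have "\<dots> = (\<Sum>t<Suc i - m. extension_count j (t + 2))"
    by (rule sum.reindex_bij_witness[of _ "\<lambda>t. i - t" "\<lambda>v. i - v"])
      (use Suc.prems in \<open>auto simp: Suc_diff_le\<close>)
  finally have pos: "card (\<Union>v\<in>{m..i}. ?pos v) = (\<Sum>t<Suc i - m. extension_count j (t + 2))" .
  have "?zero \<inter> (\<Union>v\<in>{m..i}. ?pos v) = {}"
    using Suc.prems by auto
  then show ?case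
    unfolding extensions_Suc[OF Suc.prems(1)]
    using fin pos IH0 by (simp add: card_Un_disjoint card_image)
qed

lemma card_inversion_sequences_sorted_positive_part:
  "card {e \<in> inversion_sequences n. sorted (positive_part e)} = extension_count n 0"
proof -
  have "{e \<in> inversion_sequences n. sorted (positive_part e)} = extensions 0 1 n"
    by (auto simp: extensions_def inversion_sequences_def)
  then show ?thesis using card_extensions[of 1 0 n] by simp
qed

section \<open>Counting paths step by step\<close>

text \<open>A path from height \<open>h\<close> to height \<open>0\<close> with \<open>j\<close> steps other than \<open>(1, -1)\<close> has \<open>h\<close> more
  down steps than up steps, so its horizontal extent is \<open>2 j + h\<close>.\<close>

definition descending_paths :: "nat \<Rightarrow> nat \<Rightarrow> (int \<times> int) list set" where
  "descending_paths j h = {s. set s \<subseteq> {(1, 1), (1, -1), (2, 0)} \<and>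
     (\<forall>k\<le>length s. 0 \<le> int h + snd (sum_list (take k s))) \<and>
     sum_list s = (2 * int j + int h, - int h)}"

fun descent_count :: "nat \<Rightarrow> nat \<Rightarrow> nat" where
  "descent_count 0 h = 1"
| "descent_count (Suc j) 0 = descent_count j 0 + descent_count j 1"
| "descent_count (Suc j) (Suc h) =
     descent_count (Suc j) h + descent_count j (Suc h) + descent_count j (Suc (Suc h))"

lemma abs_snd_sum_list_le_fst:
  fixes s :: "(int \<times> int) list"
  assumes "set s \<subseteq> {(1, 1), (1, -1), (2, 0)}"
  shows "\<bar>snd (sum_list s)\<bar> \<le> fst (sum_list s)"
  using assms by (induction s) auto

lemma schroeder_paths_eq: "schroeder_paths m = descending_paths m 0"
proof -
  have "0 \<le> fst (sum_list (take k s))" if "set s \<subseteq> {(1, 1), (1, -1), (2, 0)}"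
    for k and s :: "(int \<times> int) list"
    using abs_snd_sum_list_le_fst[of "take k s"] that set_take_subset[of k s] by fastforce
  then show ?thesis by (auto simp: schroeder_paths_def descending_paths_def)
qed

lemma Nil_in_descending_paths: "[] \<in> descending_paths j h \<longleftrightarrow> j = 0 \<and> h = 0"
  by (auto simp: descending_paths_def zero_prod_def)

lemma all_prefixes_Cons:
  "(\<forall>k\<le>length (x # s). Q (take k (x # s))) \<longleftrightarrow> Q [] \<and> (\<forall>k\<le>length s. Q (x # take k s))"
  by (simp add: less_Suc_eq_le[symmetric] All_less_Suc2)

lemma Cons_in_descending_paths:
  "x # s \<in> descending_paths j h \<longleftrightarrow>
     x = (1, -1) \<and> 0 < h \<and> s \<in> descending_paths j (h - 1) \<or>
     x = (1, 1) \<and> 0 < j \<and> s \<in> descending_paths (j - 1) (Suc h) \<or>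
     x = (2, 0) \<and> 0 < j \<and> s \<in> descending_paths (j - 1) h"
proof -
  let ?steps = "{(1, 1), (1, -1), (2, 0)} :: (int \<times> int) set"
  have unfold: "x # s \<in> descending_paths j h \<longleftrightarrow> x \<in> ?steps \<and> set s \<subseteq> ?steps \<and>
      (\<forall>k\<le>length s. 0 \<le> int h + snd x + snd (sum_list (take k s))) \<and>
      x + sum_list s = (2 * int j + int h, - int h)"
    unfolding descending_paths_def mem_Collect_eq
      all_prefixes_Cons[of x s "\<lambda>t. 0 \<le> int h + snd (sum_list t)"]
    by (auto simp: add.assoc)
  have start: "0 \<le> int h + snd x" if "x # s \<in> descending_paths j h"
    using that unfolding unfold by (metis add.right_neutral le0 snd_zero sum_list.Nil take0)
  \<comment> \<open>For \<open>j = 0\<close> the whole path has horizontal extent \<open>h\<close> and descends by \<open>h\<close>. A first step other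
    than \<open>(1, -1)\<close> would leave a remainder that descends by more than its horizontal extent.\<close>
  have width: "\<bar>snd (sum_list s)\<bar> \<le> fst (sum_list s)" if "x # s \<in> descending_paths j h"
    using that unfolding unfold by (blast intro: abs_snd_sum_list_le_fst)
  consider (down) "x = (1, -1)" | (up) "x = (1, 1)" | (flat) "x = (2, 0)" | (other) "x \<notin> ?steps"
    by blast
  then show ?thesis
  proof cases
    case down
    have "0 < h" if "x # s \<in> descending_paths j h"
      using start[OF that] down by simp
    moreover have "x # s \<in> descending_paths j h \<longleftrightarrow> s \<in> descending_paths j (h - 1)" if "0 < h"
      using that unfolding unfold
      by (auto simp: down descending_paths_def prod_eq_iff of_nat_diff algebra_simps)
    ultimately show ?thesis using down by auto
  next
    case up
    have "0 < j" if "x # s \<in> descending_paths j h"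
      using width[OF that] that up unfolding unfold by (auto simp: prod_eq_iff)
    moreover have "x # s \<in> descending_paths j h \<longleftrightarrow> s \<in> descending_paths (j - 1) (Suc h)"
      if "0 < j"
      using that unfolding unfold
      by (auto simp: up descending_paths_def prod_eq_iff of_nat_diff algebra_simps)
    ultimately show ?thesis using up by auto
  next
    case flat
    have "0 < j" if "x # s \<in> descending_paths j h"
      using width[OF that] that flat unfolding unfold by (auto simp: prod_eq_iff)
    moreover have "x # s \<in> descending_paths j h \<longleftrightarrow> s \<in> descending_paths (j - 1) h"
      if "0 < j"
      using that unfolding unfold
      by (auto simp: flat descending_paths_def prod_eq_iff of_nat_diff algebra_simps)
    ultimately show ?thesis using flat by auto
  next
    case other
    then show ?thesis unfolding unfold by auto
  qed
qed

lemma card_descending_paths: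
  "finite (descending_paths j h) \<and> card (descending_paths j h) = descent_count j h"
proof (induction j h rule: descent_count.induct)
  case (1 h)
  show ?case
  proof (induction h)
    case 0
    have "descending_paths 0 0 = {[]}"
    proof (intro set_eqI)
      fix s show "s \<in> descending_paths 0 0 \<longleftrightarrow> s \<in> {[]}"
        by (cases s) (auto simp: Nil_in_descending_paths Cons_in_descending_paths)
    qed
    then show ?case by simp
  next
    case (Suc h)
    have "descending_paths 0 (Suc h) = Cons (1, -1) ` descending_paths 0 h"
    proof (intro set_eqI)
      fix s show "s \<in> descending_paths 0 (Suc h) \<longleftrightarrow> s \<in> Cons (1, -1) ` descending_paths 0 h"
        by (cases s) (auto simp: Nil_in_descending_paths Cons_in_descending_paths)
    qed
    then show ?case using Suc by (simp add: card_image)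
  qed
next
  case (2 j)
  have "descending_paths (Suc j) 0 =
      Cons (2, 0) ` descending_paths j 0 \<union> Cons (1, 1) ` descending_paths j 1" (is "_ = ?R")
  proof (intro set_eqI)
    fix s show "s \<in> descending_paths (Suc j) 0 \<longleftrightarrow> s \<in> ?R"
      by (cases s) (auto simp: Nil_in_descending_paths Cons_in_descending_paths)
  qed
  moreover have "Cons (2, 0) ` descending_paths j 0 \<inter> Cons (1, 1) ` descending_paths j 1 = {}"
    by auto
  ultimately show ?case using 2 by (simp add: card_Un_disjoint card_image)
next
  case (3 j h)
  let ?D = "Cons (1, -1) ` descending_paths (Suc j) h"
  let ?H = "Cons (2, 0) ` descending_paths j (Suc h)"
  let ?U = "Cons (1, 1) ` descending_paths j (Suc (Suc h))"
  have "descending_paths (Suc j) (Suc h) = ?D \<union> ?H \<union> ?U"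
  proof (intro set_eqI)
    fix s show "s \<in> descending_paths (Suc j) (Suc h) \<longleftrightarrow> s \<in> ?D \<union> ?H \<union> ?U"
      by (cases s) (auto simp: Nil_in_descending_paths Cons_in_descending_paths)
  qed
  moreover have "?D \<inter> ?H = {}" "(?D \<union> ?H) \<inter> ?U = {}" by auto
  ultimately show ?case using 3 by (simp add: card_Un_disjoint card_image)
qed

section \<open>Matching the two recurrences\<close>

text \<open>By Pascal's rule, \<open>binomial_sum f k h\<close> is \<open>\<Sum>i\<le>k. (k choose i) * f (h + i)\<close>. The recursive
  form makes it evident that a linear recurrence for \<open>f\<close> is inherited.\<close>

primrec binomial_sum :: "(nat \<Rightarrow> nat) \<Rightarrow> nat \<Rightarrow> nat \<Rightarrow> nat" where
  "binomial_sum f 0 h = f h"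
| "binomial_sum f (Suc k) h = binomial_sum f k h + binomial_sum f k (Suc h)"

lemma binomial_sum_descent_count_0: "binomial_sum (descent_count 0) k h = 2 ^ k"
  by (induction k arbitrary: h) simp_all

lemma binomial_sum_descent_count_Suc:
  "binomial_sum (descent_count (Suc j)) k (Suc h) = binomial_sum (descent_count (Suc j)) k h +
     binomial_sum (descent_count j) k (Suc h) + binomial_sum (descent_count j) k (Suc (Suc h))"
  by (induction k arbitrary: h) simp_all

text \<open>The recurrences of both sides become local once consecutive values of \<open>k\<close> are compared:
  the sum in \<open>extension_count\<close> telescopes, and on the other side the difference is governed by the
  recurrence of \<open>descent_count\<close>.\<close>

lemma extension_count_binomial:
  "2 ^ k * extension_count j (Suc k) = binomial_sum (descent_count j) k 0"
proof (induction j arbitrary: k)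
  case 0
  show ?case by (simp only: binomial_sum_descent_count_0 extension_count.simps mult_1_right)
next
  case (Suc j)
  note IH = Suc.IH
  show ?case
  proof (induction k)
    case 0
    show ?case using IH[of 1] by (simp add: numeral_2_eq_2)
  next
    case (Suc k)
    have "extension_count (Suc j) (Suc (Suc k)) + extension_count j (Suc (Suc k)) =
        extension_count (Suc j) (Suc k) + 2 * extension_count j (Suc (Suc (Suc k)))"
      by simp
    from arg_cong[OF this, of "(*) (2 ^ Suc k)"]
    have "2 ^ Suc k * extension_count (Suc j) (Suc (Suc k)) +
          2 ^ Suc k * extension_count j (Suc (Suc k)) =
        2 * (2 ^ k * extension_count (Suc j) (Suc k)) +
          2 ^ Suc (Suc k) * extension_count j (Suc (Suc (Suc k)))"
      by (simp only: distrib_left power_Suc ac_simps)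
    then show ?case
      unfolding IH Suc.IH by (simp add: binomial_sum_descent_count_Suc)
  qed
qed

theorem theorem2p18:
  fixes n :: nat and p :: "nat list \<times> nat list"
  assumes "n \<ge> 1"
    and "p \<in> {([0, 2, 1], [2, 1, 0]), ([0, 2, 1], [2, 0, 1])}"
  shows "card (inversion_sequences_avoiding n p) = large_schroeder n"
proof -
  obtain m where n: "n = Suc m" using assms(1) by (cases n) auto
  have "card (inversion_sequences_avoiding n p) = extension_count n 0"
    by (simp add: inversion_sequences_avoiding_eq[OF assms(2)]
        card_inversion_sequences_sorted_positive_part)
  also have "\<dots> = extension_count m 1" by (simp add: n)
  also have "\<dots> = descent_count m 0" using extension_count_binomial[of 0 m] by simp
  also have "\<dots> = large_schroeder n"
    by (simp add: n large_schroeder_def schroeder_paths_eq card_descending_paths)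
  finally show ?thesis .
qed

end
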